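(* Let $H$ be a finite Boolean algebra, let $M$ be a Heyting module over $H$ and let $i:N\hookrightarrow M$ be a Heyting submodule. If $m\in M$ is such that $\phi_1(m)=\phi_2(m)$ for every pair $(\phi_1,\phi_2)\in M^{\bigstar}\times M^{\bigstar}$ with $\phi_1\circ i=\phi_2\circ i$, then $m\in N$.
   Context: Lattices have all finite meets and joins (hence a least element $0$ and a greatest element $1$). A join semilattice is a poset in which every finite subset, including the empty one, has a join; its least element is $0$. For a distributive lattice $L$, a distributive module over $L$ is a join semilattice $M$ with an action $L\times M\to M$, $(x,m)\mapsto x\wedge m$, order preserving in both variables, such that $1\wedge m=m$, $0\wedge m=0$, $(x\wedge y)\wedge m=x\wedge(y\wedge m)$, $(x\vee y)\wedge m=(x\wedge m)\vee(y\wedge m)$, $x\wedge(m\vee n)=(x\wedge m)\vee(x\wedge n)$. Morphisms are maps preserving finite joins (including $0$) and satisfying $g(x\wedge m)=x\wedge g(m)$. A Heyting algebra $H$ is a lattice such that for all $y,z\in H$ there is $(y\to z)_H\in H$ with $x\wedge y\le z\Leftrightarrow x\le (y\to z)_H$ for all $x\in H$ (every Boolean algebra is one). A Heyting module over $H$ is a distributive module $M$ over $H$ such that for all $m,n\in M$ there is $(m\to n)_M\in H$ with $x\wedge m\le n\Leftrightarrow x\le(m\to n)_M$ for all $x\in H$; morphisms are morphisms of distributive modules. A Heyting submodule of $M$ is a subset closed under finite joins (so containing $0$) and under the action of $H$. $H$ is a Heyting module over itself and $M^{\bigstar}$ denotes the set of morphisms of Heyting modules $M\to H$. *)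

theory Defs
  imports Main
begin

text \<open>
  Lattices with all finite meets and joins are the types of class \<open>bounded_lattice\<close>, and join
  semilattices with least element are the types of class \<open>bounded_semilattice_sup_bot\<close>.
  In neither class are the least and greatest elements required to be distinct.
\<close>

class heyting_algebra = bounded_lattice +
  assumes ex_implication: "\<exists>w. \<forall>x. inf x y \<le> z \<longleftrightarrow> x \<le> w"
begin

subclass distrib_lattice
proof
  have *: "inf x (sup y z) \<le> sup (inf x y) (inf x z)" for x y z
  proof -
    obtain w where w: "\<And>a. inf a x \<le> sup (inf x y) (inf x z) \<longleftrightarrow> a \<le> w"
      using ex_implication by metis
    have "y \<le> w" "z \<le> w"
      by (simp_all add: w[symmetric] inf_commute)
    then have "sup y z \<le> w"
      by simp
    then show ?thesis
      by (simp add: w[symmetric] inf_commute)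
  qed
  have "inf x (sup y z) = sup (inf x y) (inf x z)" for x y z
    by (rule order.antisym[OF * distrib_inf_le])
  then show "sup x (inf y z) = inf (sup x y) (sup x z)" for x y z
    by (rule distrib_imp1)
qed

end

subclass (in boolean_algebra) heyting_algebra
proof
  fix y z :: 'a
  show "\<exists>w. \<forall>x. inf x y \<le> z \<longleftrightarrow> x \<le> w"
    by (rule exI[of _ "sup (- y) z"]) (simp add: shunt1)
qed

locale distributive_module =
  fixes act :: "'h::{distrib_lattice, bounded_lattice} \<Rightarrow> 'm::bounded_semilattice_sup_bot \<Rightarrow> 'm"
  assumes act_mono: "x \<le> y \<Longrightarrow> m \<le> n \<Longrightarrow> act x m \<le> act y n"
    and act_top: "act top m = m"
    and act_bot: "act bot m = bot"
    and act_inf: "act (inf x y) m = act x (act y m)"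
    and act_sup_left: "act (sup x y) m = sup (act x m) (act y m)"
    and act_sup_right: "act x (sup m n) = sup (act x m) (act x n)"

locale heyting_module = distributive_module act
  for act :: "'h::heyting_algebra \<Rightarrow> 'm::bounded_semilattice_sup_bot \<Rightarrow> 'm" +
  assumes ex_module_implication: "\<exists>w. \<forall>x. act x m \<le> n \<longleftrightarrow> x \<le> w"

locale distributive_module_hom =
  dom: distributive_module act\<^sub>1 + cod: distributive_module act\<^sub>2
  for act\<^sub>1 :: "'h::{distrib_lattice, bounded_lattice} \<Rightarrow> 'm::bounded_semilattice_sup_bot \<Rightarrow> 'm"
    and act\<^sub>2 :: "'h \<Rightarrow> 'n::bounded_semilattice_sup_bot \<Rightarrow> 'n" +
  fixes g :: "'m \<Rightarrow> 'n"
  assumes hom_bot: "g bot = bot"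
    and hom_sup: "g (sup m n) = sup (g m) (g n)"
    and hom_act: "g (act\<^sub>1 x m) = act\<^sub>2 x (g m)"

text \<open>Closure under finite joins is closure under the empty and the binary ones.\<close>

locale heyting_submodule = heyting_module act
  for act :: "'h::heyting_algebra \<Rightarrow> 'm::bounded_semilattice_sup_bot \<Rightarrow> 'm" +
  fixes N :: "'m set"
  assumes bot_closed: "bot \<in> N"
    and sup_closed: "m \<in> N \<Longrightarrow> n \<in> N \<Longrightarrow> sup m n \<in> N"
    and act_closed: "m \<in> N \<Longrightarrow> act x m \<in> N"

text \<open>A Heyting algebra acts on itself by binary meets.\<close>

lemma heyting_module_inf:
  "heyting_module (inf :: 'h::heyting_algebra \<Rightarrow> 'h \<Rightarrow> 'h)"
  by unfold_locales
    (auto simp: inf_assoc inf_sup_distrib1 inf_sup_distrib2 ex_implication intro: le_infI1 le_infI2)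

text \<open>
  The set of morphisms from a Heyting module to its Heyting algebra of scalars. Morphisms of
  Heyting modules are by definition morphisms of the underlying distributive modules.
\<close>

definition module_star ::
  "('h::heyting_algebra \<Rightarrow> 'm::bounded_semilattice_sup_bot \<Rightarrow> 'm) \<Rightarrow> ('m \<Rightarrow> 'h) set"
  where "module_star act = {\<phi>. distributive_module_hom act inf \<phi>}"

end

(*
  For an atom a of H and an ideal J of the join semilattice M, the map sending x to bot if a acts
  on x into J, and to a otherwise, is a morphism from M to H. If m is not in N, then a minimal h
  such that h acts on m outside N is an atom a. With m' = a acting on m, the principal ideal
  below m' and the ideal generated by the elements of N below m' have the same trace on N, so
  their morphisms agree on N; but only the first ideal contains m'.
*)

theory Submission
  imports Defs
begin

text \<open>The equivalence \<open>J_sup\<close> encodes both closure of \<open>J\<close> under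
  joins and downward closure. Compatibility with the action holds because
  \<open>act a (act x m)\<close> is either \<open>bot\<close> or \<open>act a m\<close>, according
  to \<open>inf x a\<close>.\<close>

lemma atom_indicator_in_module_star:
  fixes act :: "'h::heyting_algebra \<Rightarrow> 'm::bounded_semilattice_sup_bot \<Rightarrow> 'm"
  assumes "distributive_module act"
    and atom: "\<And>x. inf x a = bot \<or> inf x a = a"
    and J_bot: "bot \<in> J"
    and J_sup: "\<And>m n. sup m n \<in> J \<longleftrightarrow> m \<in> J \<and> n \<in> J"
  shows "(\<lambda>m. if act a m \<in> J then bot else a) \<in> module_star act"
proof -
  interpret distributive_module act by fact
  interpret H: heyting_module "inf :: 'h \<Rightarrow> 'h \<Rightarrow> 'h"
    by (rule heyting_module_inf)
  let ?\<phi> = "\<lambda>m. if act a m \<in> J then bot else a"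
  \<comment> \<open>Write the inner \<open>bot\<close> as \<open>act bot bot\<close> and merge the
    two scalars.\<close>
  have bot: "act a bot = bot"
    using act_inf[of a bot bot] by (simp add: act_bot)
  have "?\<phi> (act x m) = inf x (?\<phi> m)" for x m
    using atom[of x] by (auto simp: act_inf[symmetric] inf_commute[of a x] act_bot J_bot)
  then have "distributive_module_hom act inf ?\<phi>"
    by unfold_locales (simp_all add: bot J_bot act_sup_right J_sup)
  then show ?thesis
    by (simp add: module_star_def)
qed

text \<open>Finiteness gives a minimal scalar \<open>a\<close> moving \<open>m\<close> outside
  \<open>N\<close>. If some \<open>x\<close> split \<open>a\<close> into two strictly smaller parts,
  both would act on \<open>m\<close> into \<open>N\<close>, and so would their join
  \<open>a\<close>.\<close>

lemma ex_atom_act_notin_submodule: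
  fixes act :: "'h::{finite, boolean_algebra} \<Rightarrow> 'm::bounded_semilattice_sup_bot \<Rightarrow> 'm"
  assumes "heyting_submodule act N" and "m \<notin> N"
  obtains a where "act a m \<notin> N" and "\<And>x. inf x a = bot \<or> inf x a = a"
proof -
  interpret heyting_submodule act N by fact
  have "top \<in> {h. act h m \<notin> N}"
    using \<open>m \<notin> N\<close> by (simp add: act_top)
  from finite_has_minimal2[OF finite this]
  obtain a where a: "act a m \<notin> N"
    and minimal: "\<And>h. act h m \<notin> N \<Longrightarrow> h \<le> a \<Longrightarrow> a = h"
    by auto
  have "inf x a = bot \<or> inf x a = a" for x
  proof (rule ccontr)
    assume *: "\<not> (inf x a = bot \<or> inf x a = a)"
    \<comment> \<open>Otherwise \<open>a\<close> lies below \<open>- x\<close>, so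
      \<open>inf x a\<close> is \<open>bot\<close>.\<close>
    have "inf (- x) a \<noteq> a"
      using * inf_shunt[of a x] by (auto simp: inf.absorb_iff1 inf_commute)
    with * have "act (inf x a) m \<in> N" "act (inf (- x) a) m \<in> N"
      using minimal[of "inf x a"] minimal[of "inf (- x) a"] by fastforce+
    then have "act (sup (inf x a) (inf (- x) a)) m \<in> N"
      by (simp add: act_sup_left sup_closed)
    moreover have "sup (inf x a) (inf (- x) a) = a"
      by (simp flip: inf_sup_distrib2)
    ultimately show False
      using a by simp
  qed
  with a show ?thesis
    by (rule that)
qed

theorem proposition4p10:
  fixes act :: "'h::{finite, boolean_algebra} \<Rightarrow> 'm::bounded_semilattice_sup_bot \<Rightarrow> 'm"
    and N :: "'m set"
    and m :: 'm
  assumes "heyting_module act"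
    and "heyting_submodule act N"
    and "\<And>\<phi>\<^sub>1 \<phi>\<^sub>2. \<phi>\<^sub>1 \<in> module_star act \<Longrightarrow> \<phi>\<^sub>2 \<in> module_star act \<Longrightarrow>
      (\<forall>n\<in>N. \<phi>\<^sub>1 n = \<phi>\<^sub>2 n) \<Longrightarrow> \<phi>\<^sub>1 m = \<phi>\<^sub>2 m"
  shows "m \<in> N"
proof (rule ccontr)
  interpret heyting_submodule act N by fact
  assume "m \<notin> N"
  with assms(2) obtain a where a: "act a m \<notin> N"
    and atom: "\<And>x. inf x a = bot \<or> inf x a = a"
    by (rule ex_atom_act_notin_submodule) blast
  define J\<^sub>1 where "J\<^sub>1 = {x. x \<le> act a m}"
  \<comment> \<open>A single bound \<open>n\<close> suffices here, since \<open>N\<close> is closed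
    under joins.\<close>
  define J\<^sub>2 where "J\<^sub>2 = {x. \<exists>n\<in>N. n \<le> act a m \<and> x \<le> n}"
  define \<phi> where "\<phi> J x = (if act a x \<in> J then bot else a)" for J x
  have "\<phi> J\<^sub>1 \<in> module_star act"
    unfolding \<phi>_def using distributive_module_axioms atom
    by (rule atom_indicator_in_module_star) (auto simp: J\<^sub>1_def)
  moreover have "\<phi> J\<^sub>2 \<in> module_star act"
    unfolding \<phi>_def using distributive_module_axioms atom
  proof (rule atom_indicator_in_module_star)
    show "bot \<in> J\<^sub>2"
      using bot_closed by (auto simp: J\<^sub>2_def intro: bexI[of _ bot])
    show "sup x y \<in> J\<^sub>2 \<longleftrightarrow> x \<in> J\<^sub>2 \<and> y \<in> J\<^sub>2" for x y
    proof
      assume "x \<in> J\<^sub>2 \<and> y \<in> J\<^sub>2"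
      then obtain n p where "n \<in> N" "n \<le> act a m" "x \<le> n" "p \<in> N" "p \<le> act a m" "y \<le> p"
        by (auto simp: J\<^sub>2_def)
      then show "sup x y \<in> J\<^sub>2"
        unfolding J\<^sub>2_def
        by (intro CollectI bexI[of _ "sup n p"] conjI sup_mono sup_closed sup_least)
    qed (auto simp: J\<^sub>2_def)
  qed
  \<comment> \<open>For \<open>n\<close> in \<open>N\<close>, \<open>act a n\<close> is again in
    \<open>N\<close>, so once it is below \<open>act a m\<close> it is its own witness for
    \<open>J\<^sub>2\<close>.\<close>
  moreover have "\<forall>n\<in>N. \<phi> J\<^sub>1 n = \<phi> J\<^sub>2 n"
    using act_closed by (force simp: \<phi>_def J\<^sub>1_def J\<^sub>2_def)
  ultimately have "\<phi> J\<^sub>1 m = \<phi> J\<^sub>2 m"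
    by (rule assms(3))
  \<comment> \<open>This makes the two values of \<open>\<phi> J\<close> distinct, so that equal
    values give equal membership.\<close>
  moreover have "a \<noteq> bot"
    using a act_bot bot_closed by auto
  ultimately have "act a m \<in> J\<^sub>2"
    by (auto simp: \<phi>_def J\<^sub>1_def split: if_splits)
  \<comment> \<open>The witness in \<open>N\<close> lies both above and below
    \<open>act a m\<close>.\<close>
  then have "act a m \<in> N"
    by (auto simp: J\<^sub>2_def dest: order.antisym)
  with a show False ..
qed

end
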